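(* Let $k>0$, suppose $A:L^1(\mathbb{R})\to L^\infty(\mathbb{R})$ is a $k$-Hadamard operator, and suppose $f$ is doubly $L^1$ for $A$. Then \[ \|f\|_1\,\|Af\|_1\ \ge\ k\,\|f\|_\infty\,\|Af\|_\infty . \]
   Context: All functions are complex-valued and norms are with respect to Lebesgue measure on $\mathbb{R}$. Given a linear operator $A:L^1(\mathbb{R})\to L^\infty(\mathbb{R})$, a function $f$ is called doubly $L^1$ for $A$ if $f\in L^1(\mathbb{R})$ and $Af\in L^1(\mathbb{R})$. The operator $A$ is called $k$-Hadamard if $\|A\|_{1\to\infty}\le 1$ (i.e. $\|Af\|_\infty\le\|f\|_1$ for all $f\in L^1(\mathbb{R})$) and $\|A^*Af\|_\infty\ge k\|f\|_\infty$ for all $f$ that are doubly $L^1$ for $A$. Here $A^*:L^1(\mathbb{R})\to L^\infty(\mathbb{R})$ is the adjoint, determined by $\int (Af)\,\overline{g}\,dx=\int f\,\overline{A^*g}\,dx$ for all $f,g\in L^1(\mathbb{R})$. *)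

theory Defs
  imports "HOL-Probability.Essential_Supremum"
begin

text \<open>
  Elements of the Lebesgue spaces on the real line are represented by functions; equality in
  these spaces is equality almost everywhere. An operator from \<open>L\<^sup>1\<close> to \<open>L\<^sup>\<infinity>\<close> accordingly
  acts on representatives, and is only meaningful up to null sets.
\<close>

definition L1 :: "(real \<Rightarrow> complex) set" where
  "L1 = {f. integrable lebesgue f}"

definition L1_norm :: "(real \<Rightarrow> complex) \<Rightarrow> ennreal" where
  "L1_norm f = (\<integral>\<^sup>+ x. ennreal (norm (f x)) \<partial>lebesgue)"

text \<open>Extended-valued, since a function in \<open>L\<^sup>1\<close> need not be essentially bounded.\<close>

definition Linf_norm :: "(real \<Rightarrow> complex) \<Rightarrow> ennreal" where
  "Linf_norm f = esssup lebesgue (\<lambda>x. ennreal (norm (f x)))"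

definition Linf :: "(real \<Rightarrow> complex) set" where
  "Linf = {f. f \<in> borel_measurable lebesgue \<and> Linf_norm f < \<infinity>}"

definition linear_L1_Linf :: "((real \<Rightarrow> complex) \<Rightarrow> (real \<Rightarrow> complex)) \<Rightarrow> bool" where
  "linear_L1_Linf A \<longleftrightarrow>
     (\<forall>f\<in>L1. A f \<in> Linf) \<and>
     (\<forall>f\<in>L1. \<forall>g\<in>L1. (AE x in lebesgue. f x = g x) \<longrightarrow> (AE x in lebesgue. A f x = A g x)) \<and>
     (\<forall>f\<in>L1. \<forall>g\<in>L1. AE x in lebesgue. A (\<lambda>t. f t + g t) x = A f x + A g x) \<and>
     (\<forall>c. \<forall>f\<in>L1. AE x in lebesgue. A (\<lambda>t. c * f t) x = c * A f x)"

definition is_adjoint ::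
  "((real \<Rightarrow> complex) \<Rightarrow> (real \<Rightarrow> complex)) \<Rightarrow> ((real \<Rightarrow> complex) \<Rightarrow> (real \<Rightarrow> complex)) \<Rightarrow> bool" where
  "is_adjoint A B \<longleftrightarrow>
     (\<forall>g\<in>L1. B g \<in> Linf) \<and>
     (\<forall>f\<in>L1. \<forall>g\<in>L1.
        (LINT x|lebesgue. A f x * cnj (g x)) = (LINT x|lebesgue. f x * cnj (B g x)))"

text \<open>
  If \<open>A\<close> is linear and bounded from \<open>L\<^sup>1\<close> to \<open>L\<^sup>\<infinity>\<close>, an adjoint exists by the duality of these
  spaces, and \<open>B g\<close> is determined almost everywhere for each \<open>g\<close> in \<open>L\<^sup>1\<close> (so \<open>B\<close> is linear up to
  null sets). The choice operator only picks representatives.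
\<close>

definition adjoint_op ::
  "((real \<Rightarrow> complex) \<Rightarrow> (real \<Rightarrow> complex)) \<Rightarrow> ((real \<Rightarrow> complex) \<Rightarrow> (real \<Rightarrow> complex))" where
  "adjoint_op A = (SOME B. is_adjoint A B)"

definition doubly_L1 :: "((real \<Rightarrow> complex) \<Rightarrow> (real \<Rightarrow> complex)) \<Rightarrow> (real \<Rightarrow> complex) \<Rightarrow> bool" where
  "doubly_L1 A f \<longleftrightarrow> f \<in> L1 \<and> A f \<in> L1"

text \<open>The first conjunct says that the operator norm of \<open>A\<close> from \<open>L\<^sup>1\<close> to \<open>L\<^sup>\<infinity>\<close> is at most 1.\<close>

definition k_Hadamard :: "real \<Rightarrow> ((real \<Rightarrow> complex) \<Rightarrow> (real \<Rightarrow> complex)) \<Rightarrow> bool" where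
  "k_Hadamard k A \<longleftrightarrow>
     (\<forall>f\<in>L1. Linf_norm (A f) \<le> L1_norm f) \<and>
     (\<forall>f. doubly_L1 A f \<longrightarrow> Linf_norm (adjoint_op A (A f)) \<ge> ennreal k * Linf_norm f)"

end

theory Submission
  imports Defs
begin

text \<open>
  The uncertainty principle is a product of two inequalities. The operator \<open>A\<close> is a contraction
  from \<open>L\<^sup>1\<close> to \<open>L\<^sup>\<infinity>\<close>, and so is its adjoint. Applying the first contraction to \<open>f\<close> and the second
  to \<open>A f\<close>, and then using the Hadamard lower bound, gives
  \<open>\<parallel>A f\<parallel>\<^sub>\<infinity> \<le> \<parallel>f\<parallel>\<^sub>1\<close> and \<open>k \<parallel>f\<parallel>\<^sub>\<infinity> \<le> \<parallel>A\<^sup>* A f\<parallel>\<^sub>\<infinity> \<le> \<parallel>A f\<parallel>\<^sub>1\<close>; multiply.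

  The substance lies in the adjoint, which is a choice among the operators satisfying the adjoint
  identity. Something is known about it only once such an operator exists, and this is the duality
  of \<open>L\<^sup>1\<close> and \<open>L\<^sup>\<infinity>\<close> (\<open>ex_adjoint\<close>, from \<open>L1_functional_representation\<close>): for each \<open>g\<close> in \<open>L\<^sup>1\<close> the
  bounded functional \<open>f \<mapsto> \<integral> A f \<sqdot> cnj g\<close> has to be integration against a bounded function.
  That the adjoint is a contraction (\<open>adjoint_contraction\<close>) follows from the adjoint identity by
  testing \<open>A\<^sup>* g\<close> against functions that carry its phase and live where it is
  large (\<open>AE_norm_le_if_pairing_bounded\<close>).

  The duality holds on every \<open>\<sigma>\<close>-finite measure space and rests on the Radon-Nikodym theorem.
  For a real functional \<open>\<phi>\<close> with \<open>\<bar>\<phi> f\<bar> \<le> C \<parallel>f\<parallel>\<^sub>1\<close>, the set function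
  \<open>E \<mapsto> \<phi> (w 1\<^sub>E) + C \<integral>\<^sub>E w\<close>, with a strictly positive integrable weight \<open>w\<close>, is nonnegative, because the
  second term dominates the first whatever its sign. The weight
  makes it a finite measure that is defined on all measurable sets, at most \<open>2 C \<integral>\<^sub>E w\<close>. If \<open>v\<close> is
  its density, then \<open>v / w - C\<close> represents \<open>\<phi>\<close> on the functions \<open>w 1\<^sub>E\<close>; these span a dense
  subspace of \<open>L\<^sup>1\<close>.
\<close>

section \<open>Additive functionals bounded in the mean\<close>

text \<open>
  Homogeneity is left out so that the real and the imaginary part of a complex functional are
  instances as well. Functions that agree almost everywhere have the same value, because the
  bound applies to their difference.
\<close>

locale bounded_L1_functional = sigma_finite_measure M
  for M :: "'a measure" +
  fixes \<phi> :: "('a \<Rightarrow> complex) \<Rightarrow> 'b::real_normed_vector"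
    and C :: real
  assumes additive: "\<lbrakk>integrable M f; integrable M g\<rbrakk> \<Longrightarrow> \<phi> (\<lambda>x. f x + g x) = \<phi> f + \<phi> g"
    and bound: "integrable M f \<Longrightarrow> norm (\<phi> f) \<le> C * (\<integral>x. norm (f x) \<partial>M)"
begin

lemma diff:
  assumes "integrable M f" "integrable M g"
  shows "\<phi> (\<lambda>x. f x - g x) = \<phi> f - \<phi> g"
  using additive[of "\<lambda>x. f x - g x" g] assms by simp

lemma zero: "\<phi> (\<lambda>x. 0) = 0"
  using bound[of "\<lambda>x. 0"] by simp

text \<open>
  This continuity serves twice: along increasing unions it makes set functions built from \<open>\<phi>\<close>
  countably additive, and along simple functions it extends identities to all of \<open>L\<^sup>1\<close>.
\<close>

lemma tendsto_dominated:
  assumes f: "integrable M f" and s: "\<And>i. integrable M (s i)" and w: "integrable M w"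
    and lim: "\<And>x. x \<in> space M \<Longrightarrow> (\<lambda>i. s i x) \<longlonglongrightarrow> f x"
    and dom: "\<And>i x. x \<in> space M \<Longrightarrow> norm (s i x) \<le> w x"
  shows "(\<lambda>i. \<phi> (s i)) \<longlonglongrightarrow> \<phi> f"
proof -
  have "(\<lambda>i. \<integral>x. norm (s i x - f x) \<partial>M) \<longlonglongrightarrow> (\<integral>x. 0 \<partial>M)"
  proof (rule integral_dominated_convergence[where w = "\<lambda>x. w x + norm (f x)"])
    show "AE x in M. (\<lambda>i. norm (s i x - f x)) \<longlonglongrightarrow> 0"
    proof (rule AE_I2)
      fix x assume "x \<in> space M"
      from tendsto_diff[OF lim[OF this] tendsto_const[of "f x"]]
      show "(\<lambda>i. norm (s i x - f x)) \<longlonglongrightarrow> 0"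
        by (simp add: tendsto_norm_zero)
    qed
    show "AE x in M. norm (norm (s i x - f x)) \<le> w x + norm (f x)" for i
      using dom[of _ i] by (auto intro!: AE_I2 order_trans[OF norm_triangle_ineq4] add_right_mono)
  qed (use f s w in auto)
  then have "(\<lambda>i. C * (\<integral>x. norm (s i x - f x) \<partial>M)) \<longlonglongrightarrow> 0"
    using tendsto_mult_right_zero by fastforce
  moreover have "norm (\<phi> (s i) - \<phi> f) \<le> C * (\<integral>x. norm (s i x - f x) \<partial>M)" for i
    using bound[of "\<lambda>x. s i x - f x"] diff[OF s[of i] f] f s[of i] by simp
  ultimately have "(\<lambda>i. \<phi> (s i) - \<phi> f) \<longlonglongrightarrow> 0"
    by (intro Lim_null_comparison[of "\<lambda>i. \<phi> (s i) - \<phi> f"]) auto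
  then show ?thesis
    by (rule LIM_zero_cancel)
qed

text \<open>
  Multiplication by \<open>w\<close> maps the space of functions integrable for \<open>density M w\<close> onto \<open>L\<^sup>1\<close> of
  \<open>M\<close>, and it turns indicators into the functions of the hypothesis. So the claim is the density
  of simple functions in the weighted space.
\<close>

lemma eq_0_if_eq_0_on_weighted_indicators:
  fixes w :: "'a \<Rightarrow> real"
  assumes w: "integrable M w" and wpos: "\<And>x. w x > 0"
    and zero_ind: "\<And>E c. E \<in> sets M \<Longrightarrow> \<phi> (\<lambda>x. c * of_real (w x * indicator E x)) = 0"
    and f: "integrable M f"
  shows "\<phi> f = 0"
proof -
  have wm [measurable]: "w \<in> borel_measurable M"
    using w by auto
  have dens: "integrable (density M w) g \<longleftrightarrow> integrable M (\<lambda>x. of_real (w x) * g x)"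
    if "g \<in> borel_measurable M" for g :: "'a \<Rightarrow> complex"
    using that by (subst integrable_density) (auto simp: scaleR_conv_of_real less_imp_le wpos)
  have meas: "g \<in> borel_measurable M" if "integrable (density M w) g" for g :: "'a \<Rightarrow> complex"
    using borel_measurable_integrable[OF that] by simp
  have step: "\<phi> (\<lambda>x. of_real (w x) * g x) = 0" if "integrable (density M w) g" for g
    using that
  proof (induction rule: integrable_induct)
    case (base A c)
    have "(\<lambda>x. of_real (w x) * (indicat_real A x *\<^sub>R c)) = (\<lambda>x. c * of_real (w x * indicator A x))"
      by (auto simp: scaleR_conv_of_real)
    with base zero_ind[of A c] show ?case
      by simp
  next
    case (add f g)
    have "integrable M (\<lambda>x. of_real (w x) * f x)" "integrable M (\<lambda>x. of_real (w x) * g x)"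
      using add dens meas by blast+
    from additive[OF this] add show ?case
      by (simp add: distrib_left)
  next
    case (lim f s)
    have F: "integrable M (\<lambda>x. of_real (w x) * f x)"
      using lim dens meas by blast
    have "(\<lambda>i. \<phi> (\<lambda>x. of_real (w x) * s i x)) \<longlonglongrightarrow> \<phi> (\<lambda>x. of_real (w x) * f x)"
    proof (rule tendsto_dominated[OF F, where w = "\<lambda>x. 2 * norm (of_real (w x) * f x)"])
      show "integrable M (\<lambda>x. of_real (w x) * s i x)" for i
        using lim dens meas by blast
      show "integrable M (\<lambda>x. 2 * norm (of_real (w x) * f x))"
        using F by auto
      fix x assume "x \<in> space M"
      with lim show "(\<lambda>i. of_real (w x) * s i x) \<longlonglongrightarrow> of_real (w x) * f x"
        by (intro tendsto_mult_left) auto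
      fix i
      have "norm (s i x) \<le> 2 * norm (f x)"
        using lim \<open>x \<in> space M\<close> by auto
      from mult_left_mono[OF this, of "\<bar>w x\<bar>"]
      show "norm (of_real (w x) * s i x) \<le> 2 * norm (of_real (w x) * f x)"
        by (simp add: norm_mult)
    qed
    with lim show ?case
      by (simp add: LIMSEQ_const_iff)
  qed
  have fm [measurable]: "f \<in> borel_measurable M"
    using f by auto
  have wf: "(\<lambda>x. of_real (w x) * (f x / of_real (w x))) = f"
    using wpos by (auto simp: less_imp_neq[symmetric])
  have "integrable (density M w) (\<lambda>x. f x / of_real (w x))"
    by (rule dens[THEN iffD2]) (simp, unfold wf, rule f)
  from step[OF this] show ?thesis
    unfolding wf .
qed

end

section \<open>The dual of the space of integrable functions\<close>

text \<open>On the set where \<open>v < u\<close> the nonnegative function \<open>u - v\<close> has integral at most \<open>0\<close>.\<close>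

lemma AE_le_if_integrals_le:
  fixes u v :: "'a \<Rightarrow> real"
  assumes u: "integrable M u" and v: "integrable M v"
    and le: "\<And>E. E \<in> sets M \<Longrightarrow> (\<integral>x. u x * indicator E x \<partial>M) \<le> (\<integral>x. v x * indicator E x \<partial>M)"
  shows "AE x in M. u x \<le> v x"
proof -
  have [measurable]: "u \<in> borel_measurable M" "v \<in> borel_measurable M"
    using u v by auto
  define E where "E = {x \<in> space M. v x < u x}"
  have E: "E \<in> sets M"
    unfolding E_def by measurable
  have iu: "integrable M (\<lambda>x. u x * indicator E x)" and iv: "integrable M (\<lambda>x. v x * indicator E x)"
    using u v E by (auto intro: integrable_real_mult_indicator)
  have nn: "AE x in M. 0 \<le> u x * indicator E x - v x * indicator E x"
    by (auto simp: E_def indicator_def)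
  have "(\<integral>x. u x * indicator E x - v x * indicator E x \<partial>M) = 0"
    using le[OF E] iu iv integral_nonneg_AE[OF nn] by simp
  then have "AE x in M. u x * indicator E x - v x * indicator E x = 0"
    using integral_nonneg_eq_0_iff_AE[OF _ nn] iu iv by simp
  then show ?thesis
    using AE_space by eventually_elim (auto simp: E_def indicator_def split: if_splits)
qed

text \<open>
  The Radon-Nikodym step. The density of \<open>E \<mapsto> \<phi> (w 1\<^sub>E) + C \<integral>\<^sub>E w\<close> lies between \<open>0\<close> and \<open>2 C w\<close>, since
  the set function lies between \<open>0\<close> and \<open>2 C \<integral>\<^sub>E w\<close>. Dividing by \<open>w\<close> and removing the shift by \<open>C\<close>
  yields a function between \<open>-C\<close> and \<open>C\<close>.
\<close>

lemma (in sigma_finite_measure) real_functional_weighted_density: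
  fixes \<phi> :: "('a \<Rightarrow> complex) \<Rightarrow> real" and w :: "'a \<Rightarrow> real"
  assumes \<phi>: "bounded_L1_functional M \<phi> C"
    and w: "integrable M w" and wpos: "\<And>x. w x > 0"
  shows "\<exists>h\<in>borel_measurable M. (AE x in M. \<bar>h x\<bar> \<le> C) \<and>
    (\<forall>E\<in>sets M. \<phi> (\<lambda>x. of_real (w x * indicator E x)) = (\<integral>x. h x * (w x * indicator E x) \<partial>M))"
proof -
  interpret bounded_L1_functional M \<phi> C by fact
  have wm [measurable]: "w \<in> borel_measurable M"
    using w by auto
  define e where "e E = (\<lambda>x. complex_of_real (w x * indicator E x))" for E
  define I where "I E = (\<integral>x. w x * indicator E x \<partial>M)" for E
  define m where "m E = \<phi> (e E) + C * I E" for E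
  have iw: "integrable M (\<lambda>x. w x * indicator E x)" if "E \<in> sets M" for E
    using w that by (auto intro: integrable_real_mult_indicator)
  have ie: "integrable M (e E)" if "E \<in> sets M" for E
    unfolding e_def using iw[OF that] by (rule integrable_of_real)
  have ne: "(\<integral>x. norm (e E x) \<partial>M) = I E" for E
    unfolding e_def I_def using wpos
    by (intro Bochner_Integration.integral_cong) (auto simp: indicator_def less_imp_le)
  have ab: "\<bar>\<phi> (e E)\<bar> \<le> C * I E" if "E \<in> sets M" for E
    using bound[OF ie[OF that]] by (simp add: ne)
  have m_nonneg: "0 \<le> m E" and m_le: "m E \<le> 2 * C * I E" if "E \<in> sets M" for E
    using ab[OF that] by (auto simp: m_def)
  have m_add: "m (A \<union> B) = m A + m B" if "A \<in> sets M" "B \<in> sets M" "A \<inter> B = {}" for A B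
  proof -
    have ind: "w x * indicator (A \<union> B) x = w x * indicator A x + w x * indicator B x" for x
      using that(3) by (auto simp: indicator_def)
    have "e (A \<union> B) = (\<lambda>x. e A x + e B x)"
      unfolding e_def ind by simp
    moreover have "I (A \<union> B) = I A + I B"
      unfolding I_def ind using that iw by simp
    ultimately show ?thesis
      using additive[OF ie ie] that by (simp add: m_def distrib_left)
  qed
  have m_empty: "m {} = 0"
    using zero by (simp add: m_def e_def I_def)
  have m_sums: "(\<lambda>i. m (A i)) sums m (\<Union>i. A i)"
    if A: "range A \<subseteq> sets M" and dj: "disjoint_family A" for A :: "nat \<Rightarrow> 'a set"
  proof -
    define U where "U n = (\<Union>i<n. A i)" for n
    have U: "U n \<in> sets M" for n
      unfolding U_def using A by auto
    have UN: "(\<Union>i. A i) \<in> sets M"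
      using A by auto
    have part: "(\<Sum>i<n. m (A i)) = m (U n)" for n
    proof (induction n)
      case (Suc n)
      have "U (Suc n) = U n \<union> A n"
        by (auto simp: U_def less_Suc_eq)
      moreover have "U n \<inter> A n = {}"
        using disjoint_family_onD[OF dj, of _ n] by (force simp: U_def)
      ultimately show ?case
        using Suc m_add[of "U n" "A n"] U A by auto
    qed (simp add: U_def m_empty)
    have U_ind: "(\<lambda>n. w x * indicator (U n) x) \<longlonglongrightarrow> w x * indicator (\<Union>i. A i) x" for x
      unfolding U_def by (intro tendsto_mult_left LIMSEQ_indicator_UN)
    have "(\<lambda>n. I (U n)) \<longlonglongrightarrow> I (\<Union>i. A i)"
      unfolding I_def
    proof (rule integral_dominated_convergence[where w = w])
      show "AE x in M. norm (w x * indicator (U n) x) \<le> w x" for n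
        using wpos by (auto simp: indicator_def less_imp_le)
    qed (use w U_ind U UN in auto)
    moreover have "(\<lambda>n. \<phi> (e (U n))) \<longlonglongrightarrow> \<phi> (e (\<Union>i. A i))"
    proof (rule tendsto_dominated[OF ie[OF UN] ie[OF U] w])
      show "(\<lambda>n. e (U n) x) \<longlonglongrightarrow> e (\<Union>i. A i) x" for x
        unfolding e_def by (intro tendsto_of_real U_ind)
      show "norm (e (U n) x) \<le> w x" for n x
        using wpos[of x] by (auto simp: e_def indicator_def less_imp_le)
    qed
    ultimately have "(\<lambda>n. m (U n)) \<longlonglongrightarrow> m (\<Union>i. A i)"
      unfolding m_def by (intro tendsto_add tendsto_mult_left)
    then show ?thesis
      by (simp add: sums_def part)
  qed
  define N where "N = measure_of (space M) (sets M) (\<lambda>E. ennreal (m E))"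
  have sN: "sets N = sets M"
    by (simp add: N_def)
  have eN: "emeasure N E = ennreal (m E)" if "E \<in> sets M" for E
  proof (rule emeasure_measure_of[OF N_def])
    show "positive (sets N) (\<lambda>E. ennreal (m E))"
      by (simp add: positive_def m_empty)
    show "countably_additive (sets N) (\<lambda>E. ennreal (m E))"
    proof (rule countably_additiveI)
      fix A :: "nat \<Rightarrow> 'a set"
      assume "range A \<subseteq> sets N" "disjoint_family A"
      with m_sums[of A] m_nonneg show "(\<Sum>i. ennreal (m (A i))) = ennreal (m (\<Union>i. A i))"
        unfolding sN by (intro suminf_ennreal_eq) auto
    qed
  qed (use that sN sets.space_closed in auto)
  have "absolutely_continuous M N"
    unfolding absolutely_continuous_def
  proof
    fix E assume E: "E \<in> null_sets M"
    then have Es: "E \<in> sets M"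
      by auto
    have "AE x in M. w x * indicator E x = 0"
      using AE_not_in[OF E] by eventually_elim simp
    then have "I E = 0"
      unfolding I_def by (rule integral_eq_zero_AE)
    then show "E \<in> null_sets N"
      using m_le[OF Es] m_nonneg[OF Es] eN[OF Es] Es sN by (auto simp: null_sets_def)
  qed
  from Radon_Nikodym[OF this sN] obtain u
    where um [measurable]: "u \<in> borel_measurable M" and uN: "density M u = N"
    by auto
  have um_E: "(\<integral>\<^sup>+x. u x * indicator E x \<partial>M) = ennreal (m E)" if "E \<in> sets M" for E
    using emeasure_density[OF um that] eN[OF that] uN by simp
  have "(\<integral>\<^sup>+x. u x \<partial>M) = (\<integral>\<^sup>+x. u x * indicator (space M) x \<partial>M)"
    by (rule nn_integral_cong) auto
  also have "\<dots> \<noteq> \<infinity>"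
    using um_E[OF sets.top] by simp
  finally have "AE x in M. u x \<noteq> \<infinity>"
    using nn_integral_PInf_AE[OF um] by simp
  \<comment> \<open>The density is finite almost everywhere, as the measure \<open>N\<close> is finite; from here on it is
    treated as a real function.\<close>
  define v where "v x = enn2real (u x)" for x
  have vm [measurable]: "v \<in> borel_measurable M"
    unfolding v_def by measurable
  have uv: "AE x in M. u x = ennreal (v x)"
    using \<open>AE x in M. u x \<noteq> \<infinity>\<close> by eventually_elim (simp add: v_def less_top)
  have v_E: "has_bochner_integral M (\<lambda>x. v x * indicator E x) (m E)" if E: "E \<in> sets M" for E
  proof (rule has_bochner_integral_nn_integral)
    have "(\<integral>\<^sup>+x. ennreal (v x * indicator E x) \<partial>M) = (\<integral>\<^sup>+x. u x * indicator E x \<partial>M)"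
      using uv by (intro nn_integral_cong_AE) (auto elim!: eventually_mono simp: indicator_def)
    then show "(\<integral>\<^sup>+x. ennreal (v x * indicator E x) \<partial>M) = ennreal (m E)"
      by (simp add: um_E[OF E])
  qed (use E m_nonneg[OF E] in \<open>auto simp: v_def\<close>)
  have iv: "integrable M v"
  proof -
    have "integrable M (\<lambda>x. v x * indicator (space M) x)"
      using v_E[OF sets.top] by (rule integrable.intros)
    then show ?thesis
      by (rule Bochner_Integration.integrable_cong[THEN iffD1, rotated -1]) auto
  qed
  have v_le: "AE x in M. v x \<le> 2 * C * w x"
  proof (rule AE_le_if_integrals_le[OF iv])
    show "integrable M (\<lambda>x. 2 * C * w x)"
      using w by auto
    show "(\<integral>x. v x * indicator E x \<partial>M) \<le> (\<integral>x. 2 * C * w x * indicator E x \<partial>M)"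
      if "E \<in> sets M" for E
      using m_le[OF that] has_bochner_integral_integral_eq[OF v_E[OF that]]
      by (simp add: I_def mult.assoc)
  qed
  define h where "h x = v x / w x - C" for x
  have "AE x in M. \<bar>h x\<bar> \<le> C"
    using v_le
  proof eventually_elim
    case (elim x)
    then have "v x / w x \<le> 2 * C" "0 \<le> v x / w x"
      using wpos[of x] by (auto simp: field_simps v_def)
    then show ?case
      by (auto simp: h_def)
  qed
  moreover have "h \<in> borel_measurable M"
    unfolding h_def by measurable
  moreover have "\<phi> (e E) = (\<integral>x. h x * (w x * indicator E x) \<partial>M)" if E: "E \<in> sets M" for E
  proof -
    have eq: "h x * (w x * indicator E x) = v x * indicator E x - C * (w x * indicator E x)" for x
      using wpos[of x] by (simp add: h_def field_simps)
    have "(\<integral>x. h x * (w x * indicator E x) \<partial>M) = m E - C * I E"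
      unfolding eq I_def using v_E[OF E] iw[OF E]
      by (subst Bochner_Integration.integral_diff)
        (auto simp: has_bochner_integral_iff)
    then show ?thesis
      by (simp add: m_def)
  qed
  ultimately show ?thesis
    unfolding e_def by blast
qed

lemma borel_measurable_cnj [measurable (raw)]:
  "f \<in> borel_measurable M \<Longrightarrow> (\<lambda>x. cnj (f x)) \<in> borel_measurable M"
  by (rule measurable_compose[OF _ borel_measurable_continuous_onI]) (auto intro: continuous_intros)

lemma integrable_mult_AE_bounded:
  fixes f h :: "'a \<Rightarrow> complex"
  assumes f: "integrable M f" and [measurable]: "h \<in> borel_measurable M"
    and h: "AE x in M. norm (h x) \<le> K"
  shows "integrable M (\<lambda>x. f x * h x)"
    and "norm (\<integral>x. f x * h x \<partial>M) \<le> K * (\<integral>x. norm (f x) \<partial>M)"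
proof -
  have [measurable]: "f \<in> borel_measurable M"
    using f by auto
  have le: "AE x in M. norm (f x * h x) \<le> K * norm (f x)"
    using h by eventually_elim (simp add: norm_mult mult.commute[of K] mult_left_mono)
  then have le': "AE x in M. norm (f x * h x) \<le> norm (K * norm (f x))"
    by eventually_elim simp
  show int: "integrable M (\<lambda>x. f x * h x)"
    by (rule Bochner_Integration.integrable_bound[OF _ _ le']) (use f in auto)
  have "norm (\<integral>x. f x * h x \<partial>M) \<le> (\<integral>x. norm (f x * h x) \<partial>M)"
    by (rule integral_norm_bound)
  also have "\<dots> \<le> (\<integral>x. K * norm (f x) \<partial>M)"
    by (rule integral_mono_AE) (use f int le in auto)
  finally show "norm (\<integral>x. f x * h x \<partial>M) \<le> K * (\<integral>x. norm (f x) \<partial>M)"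
    by simp
qed

text \<open>
  The real and the imaginary part are represented separately on the functions \<open>w 1\<^sub>E\<close>. The defect
  \<open>D\<close> between the functional and its candidate representation is again additive and bounded, and
  it vanishes on these functions. Complex homogeneity enters only to pass from \<open>w 1\<^sub>E\<close> to its
  complex multiples. The constant \<open>2 C\<close> comes from adding the bounds of the two parts; it can be
  sharpened to \<open>C\<close> by \<open>AE_norm_le_if_pairing_bounded\<close> below when \<open>C\<close> is nonnegative.
\<close>

theorem (in sigma_finite_measure) L1_functional_representation:
  fixes \<phi> :: "('a \<Rightarrow> complex) \<Rightarrow> complex"
  assumes \<phi>: "bounded_L1_functional M \<phi> C"
    and scale: "\<And>c f. integrable M f \<Longrightarrow> \<phi> (\<lambda>x. c * f x) = c * \<phi> f"
  shows "\<exists>h\<in>borel_measurable M. (AE x in M. norm (h x) \<le> 2 * C) \<and>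
    (\<forall>f. integrable M f \<longrightarrow> \<phi> f = (\<integral>x. f x * h x \<partial>M))"
proof -
  interpret bounded_L1_functional M \<phi> C by fact
  obtain w :: "'a \<Rightarrow> real" where w: "integrable M w" and wpos: "\<And>x. w x > 0"
    by (rule obtain_positive_integrable_function) blast
  have "bounded_L1_functional M (\<lambda>f. Re (\<phi> f)) C"
    by unfold_locales (auto simp: additive intro: order_trans[OF abs_Re_le_cmod bound])
  from real_functional_weighted_density[OF this w wpos] obtain a where
    am [measurable]: "a \<in> borel_measurable M" and ab: "AE x in M. \<bar>a x\<bar> \<le> C" and
    a: "\<And>E. E \<in> sets M \<Longrightarrow> Re (\<phi> (\<lambda>x. of_real (w x * indicator E x))) = (\<integral>x. a x * (w x * indicator E x) \<partial>M)"
    by blast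
  have "bounded_L1_functional M (\<lambda>f. Im (\<phi> f)) C"
    by unfold_locales (auto simp: additive intro: order_trans[OF abs_Im_le_cmod bound])
  from real_functional_weighted_density[OF this w wpos] obtain b where
    bm [measurable]: "b \<in> borel_measurable M" and bb: "AE x in M. \<bar>b x\<bar> \<le> C" and
    b: "\<And>E. E \<in> sets M \<Longrightarrow> Im (\<phi> (\<lambda>x. of_real (w x * indicator E x))) = (\<integral>x. b x * (w x * indicator E x) \<partial>M)"
    by blast
  define h where "h x = Complex (a x) (b x)" for x
  have h_alt: "h = (\<lambda>x. of_real (a x) + \<i> * of_real (b x))"
    by (auto simp: h_def complex_eq_iff)
  have hm [measurable]: "h \<in> borel_measurable M"
    unfolding h_alt by measurable
  have hb: "AE x in M. norm (h x) \<le> 2 * C"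
    using ab bb
  proof eventually_elim
    case (elim x)
    then show ?case
      using cmod_le[of "h x"] by (simp add: h_def)
  qed
  define D where "D f = \<phi> f - (\<integral>x. f x * h x \<partial>M)" for f
  have D: "bounded_L1_functional M D (3 * C)"
  proof unfold_locales
    fix f g :: "'a \<Rightarrow> complex"
    assume f: "integrable M f"
    show "norm (D f) \<le> 3 * C * (\<integral>x. norm (f x) \<partial>M)"
      unfolding D_def
      using norm_triangle_ineq4[of "\<phi> f" "\<integral>x. f x * h x \<partial>M"] bound[OF f]
        integrable_mult_AE_bounded(2)[OF f hm hb] by linarith
    assume g: "integrable M g"
    show "D (\<lambda>x. f x + g x) = D f + D g"
      using f g hm hb by (simp add: D_def additive distrib_right integrable_mult_AE_bounded(1))
  qed
  have "D (\<lambda>x. c * of_real (w x * indicator E x)) = 0" if E: "E \<in> sets M" for c E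
  proof -
    define e where "e = (\<lambda>x. complex_of_real (w x * indicator E x))"
    have e: "integrable M e"
      unfolding e_def using w E by (intro integrable_of_real integrable_real_mult_indicator)
    have ieh: "integrable M (\<lambda>x. e x * h x)"
      by (rule integrable_mult_AE_bounded(1)[OF e hm hb])
    have "Re (\<integral>x. e x * h x \<partial>M) = Re (\<phi> e)" "Im (\<integral>x. e x * h x \<partial>M) = Im (\<phi> e)"
      using integral_Re[OF ieh] integral_Im[OF ieh] a[OF E] b[OF E]
      by (simp_all add: e_def h_def mult.commute)
    then have "\<phi> e = (\<integral>x. e x * h x \<partial>M)"
      by (simp add: complex_eq_iff)
    then have "D (\<lambda>x. c * e x) = 0"
      using scale[OF e, of c] ieh by (simp add: D_def mult.assoc)
    then show ?thesis
      by (simp add: e_def)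
  qed
  then have "D f = 0" if "integrable M f" for f
    using bounded_L1_functional.eq_0_if_eq_0_on_weighted_indicators[OF D w wpos] that by blast
  then show ?thesis
    using hm hb by (intro bexI[of _ h]) (auto simp: D_def)
qed

text \<open>
  The easy half of the duality, with the sharp constant. On a measurable set \<open>E\<close> the test function
  \<open>w 1\<^sub>E cnj (sgn h)\<close> turns the pairing into \<open>\<integral>\<^sub>E w \<bar>h\<bar>\<close>, which is therefore at most
  \<open>C \<integral>\<^sub>E w\<close>; since \<open>E\<close> is arbitrary and \<open>w\<close> is positive, \<open>\<bar>h\<bar> \<le> C\<close> almost everywhere.
  The crude bound \<open>K\<close> ensures that the pairings are honest integrals.
\<close>

lemma (in sigma_finite_measure) AE_norm_le_if_pairing_bounded:
  fixes h :: "'a \<Rightarrow> complex"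
  assumes hm [measurable]: "h \<in> borel_measurable M" and hb: "AE x in M. norm (h x) \<le> K"
    and C: "0 \<le> C"
    and pair: "\<And>f. integrable M f \<Longrightarrow> norm (\<integral>x. f x * h x \<partial>M) \<le> C * (\<integral>x. norm (f x) \<partial>M)"
  shows "AE x in M. norm (h x) \<le> C"
proof -
  obtain w :: "'a \<Rightarrow> real" where w: "integrable M w" and wpos: "\<And>x. w x > 0"
    by (rule obtain_positive_integrable_function) blast
  have [measurable]: "w \<in> borel_measurable M"
    using w by auto
  have wh: "integrable M (\<lambda>x. w x * norm (h x))"
    using integrable_norm[OF integrable_mult_AE_bounded(1)[OF integrable_of_real[OF w] hm hb]] wpos
    by (simp add: norm_mult less_imp_le)
  have "C * (\<integral>x. w x * indicator E x \<partial>M) \<ge> (\<integral>x. w x * norm (h x) * indicator E x \<partial>M)"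
    if E: "E \<in> sets M" for E
  proof -
    define f where "f x = complex_of_real (w x * indicator E x) * cnj (sgn (h x))" for x
    have iw: "integrable M (\<lambda>x. w x * indicator E x)"
      using w E by (rule integrable_real_mult_indicator[rotated])
    have fm: "f \<in> borel_measurable M"
      unfolding f_def sgn_div_norm using E by measurable
    have nf: "norm (f x) \<le> w x * indicator E x" for x
      using wpos[of x] by (auto simp: f_def norm_mult norm_sgn indicator_def)
    have f: "integrable M f"
      by (rule Bochner_Integration.integrable_bound[OF iw fm]) (use nf in \<open>auto intro!: AE_I2 order_trans[OF nf]\<close>)
    have fh: "f x * h x = of_real (w x * norm (h x) * indicator E x)" for x
    proof -
      have "cnj (sgn (h x)) * h x = of_real (norm (h x))"
        by (cases "h x = 0")
          (auto simp: sgn_div_norm scaleR_conv_of_real field_simps complex_norm_square[symmetric] power2_eq_square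
             mult.commute[of "cnj _"])
      then show ?thesis
        by (simp add: f_def mult.assoc mult.left_commute)
    qed
    have "(\<integral>x. w x * norm (h x) * indicator E x \<partial>M) = norm (\<integral>x. f x * h x \<partial>M)"
      unfolding fh integral_complex_of_real norm_of_real using wpos
      by (intro abs_of_nonneg[symmetric] Bochner_Integration.integral_nonneg) (simp add: less_imp_le)
    also have "\<dots> \<le> C * (\<integral>x. norm (f x) \<partial>M)"
      by (rule pair[OF f])
    also have "\<dots> \<le> C * (\<integral>x. w x * indicator E x \<partial>M)"
      by (intro mult_left_mono integral_mono) (use f iw nf C in auto)
    finally show ?thesis .
  qed
  then have "AE x in M. w x * norm (h x) \<le> C * w x"
    by (intro AE_le_if_integrals_le[OF wh]) (use w in \<open>auto simp: mult.assoc\<close>)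
  then show ?thesis
    by eventually_elim (use wpos in \<open>simp add: mult.commute\<close>)
qed

section \<open>The adjoint of a contraction\<close>

text \<open>Completion does not change the measure of the Borel sets of a countable cover.\<close>

lemma sigma_finite_lebesgue: "sigma_finite_measure (lebesgue :: 'a::euclidean_space measure)"
proof
  from lborel.sigma_finite_countable obtain A :: "'a set set" where
    A: "countable A" "A \<subseteq> sets lborel" "\<Union>A = space lborel" "\<forall>a\<in>A. emeasure lborel a \<noteq> \<infinity>"
    by blast
  then have "\<forall>a\<in>A. emeasure lebesgue a \<noteq> \<infinity>"
    by (auto simp: emeasure_completion)
  with A show "\<exists>A::'a set set. countable A \<and> A \<subseteq> sets lebesgue \<and> \<Union>A = space lebesgue \<and>
      (\<forall>a\<in>A. emeasure lebesgue a \<noteq> \<infinity>)"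
    by (intro exI[of _ A]) auto
qed

interpretation lebesgue: sigma_finite_measure "lebesgue :: real measure"
  by (rule sigma_finite_lebesgue)

lemma L1_norm_eq_integral:
  assumes "f \<in> L1"
  shows "L1_norm f = ennreal (\<integral>x. norm (f x) \<partial>lebesgue)"
  using assms unfolding L1_norm_def L1_def by (intro nn_integral_eq_integral) auto

lemma Linf_norm_le:
  assumes "f \<in> borel_measurable lebesgue" "AE x in lebesgue. norm (f x) \<le> C"
  shows "Linf_norm f \<le> ennreal C"
  unfolding Linf_norm_def
  by (rule esssup_I) (use assms in \<open>auto intro: ennreal_leI elim!: eventually_mono\<close>)

lemma AE_norm_le_Linf_norm:
  assumes "Linf_norm f \<le> ennreal C" "0 \<le> C"
  shows "AE x in lebesgue. norm (f x) \<le> C"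
  using esssup_AE[of "\<lambda>x. ennreal (norm (f x))" lebesgue]
proof eventually_elim
  case (elim x)
  then have "ennreal (norm (f x)) \<le> ennreal C"
    using assms(1) unfolding Linf_norm_def by (rule order_trans)
  then show ?case
    using assms(2) by (simp add: ennreal_le_iff)
qed

lemma LinfE:
  assumes "f \<in> Linf"
  obtains K where "0 \<le> K" "AE x in lebesgue. norm (f x) \<le> K"
proof -
  have "Linf_norm f < top"
    using assms by (simp add: Linf_def)
  then obtain K where "0 \<le> K" "Linf_norm f = ennreal K"
    using less_top_ennreal by blast
  with AE_norm_le_Linf_norm[of f K] that show thesis
    by simp
qed

lemma norm_pairing_le:
  assumes contr: "\<forall>f\<in>L1. Linf_norm (A f) \<le> L1_norm f" and lin: "linear_L1_Linf A"
    and f: "f \<in> L1" and g: "g \<in> L1"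
  shows "integrable lebesgue (\<lambda>x. A f x * cnj (g x))"
    and "norm (LINT x|lebesgue. A f x * cnj (g x))
          \<le> (\<integral>x. norm (f x) \<partial>lebesgue) * (\<integral>x. norm (g x) \<partial>lebesgue)"
proof -
  have Af: "A f \<in> borel_measurable lebesgue"
    using lin f by (auto simp: linear_L1_Linf_def Linf_def)
  have "AE x in lebesgue. norm (A f x) \<le> (\<integral>x. norm (f x) \<partial>lebesgue)"
    using contr f L1_norm_eq_integral[OF f] by (intro AE_norm_le_Linf_norm) auto
  note * = integrable_mult_AE_bounded[OF _ Af this, of "\<lambda>x. cnj (g x)"]
  show "integrable lebesgue (\<lambda>x. A f x * cnj (g x))"
    and "norm (LINT x|lebesgue. A f x * cnj (g x))
          \<le> (\<integral>x. norm (f x) \<partial>lebesgue) * (\<integral>x. norm (g x) \<partial>lebesgue)"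
    using * g by (simp_all add: L1_def mult.commute)
qed

text \<open>
  For fixed \<open>g\<close> the pairing \<open>f \<mapsto> \<integral> A f \<sqdot> cnj g\<close> is honestly additive and homogeneous, although \<open>A\<close>
  is so only up to null sets, because integration does not see these. Its representing function
  is the conjugate of the value of the adjoint at \<open>g\<close>.
\<close>

lemma ex_adjoint:
  assumes contr: "\<forall>f\<in>L1. Linf_norm (A f) \<le> L1_norm f" and lin: "linear_L1_Linf A"
  shows "\<exists>B. is_adjoint A B"
proof -
  have "\<exists>h\<in>Linf. \<forall>f\<in>L1. (LINT x|lebesgue. A f x * cnj (g x)) = (LINT x|lebesgue. f x * cnj (h x))"
    if g: "g \<in> L1" for g
  proof -
    define \<phi> where "\<phi> f = (LINT x|lebesgue. A f x * cnj (g x))" for f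
    define C where "C = (\<integral>x. norm (g x) \<partial>lebesgue)"
    note int = norm_pairing_le(1)[OF contr lin _ g]
    have Am: "A f \<in> borel_measurable lebesgue" if "f \<in> L1" for f
      using lin that by (auto simp: linear_L1_Linf_def Linf_def)
    have gm: "g \<in> borel_measurable lebesgue"
      using g by (auto simp: L1_def)
    have "bounded_L1_functional lebesgue \<phi> C"
    proof unfold_locales
      fix f\<^sub>1 f\<^sub>2 :: "real \<Rightarrow> complex"
      assume i1: "integrable lebesgue f\<^sub>1"
      then have f1: "f\<^sub>1 \<in> L1"
        by (simp add: L1_def)
      show "norm (\<phi> f\<^sub>1) \<le> C * (\<integral>x. norm (f\<^sub>1 x) \<partial>lebesgue)"
        using norm_pairing_le(2)[OF contr lin f1 g] by (simp add: \<phi>_def C_def mult.commute)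
      assume i2: "integrable lebesgue f\<^sub>2"
      then have f2: "f\<^sub>2 \<in> L1"
        by (simp add: L1_def)
      have f12: "(\<lambda>x. f\<^sub>1 x + f\<^sub>2 x) \<in> L1"
        using i1 i2 by (simp add: L1_def)
      have "AE x in lebesgue. A (\<lambda>x. f\<^sub>1 x + f\<^sub>2 x) x = A f\<^sub>1 x + A f\<^sub>2 x"
        using lin f1 f2 by (simp add: linear_L1_Linf_def)
      then have "\<phi> (\<lambda>x. f\<^sub>1 x + f\<^sub>2 x) =
          (LINT x|lebesgue. A f\<^sub>1 x * cnj (g x) + A f\<^sub>2 x * cnj (g x))"
        unfolding \<phi>_def using Am[OF f12] Am[OF f1] Am[OF f2] gm
        by (intro integral_cong_AE) (auto elim!: eventually_mono simp: distrib_right)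
      then show "\<phi> (\<lambda>x. f\<^sub>1 x + f\<^sub>2 x) = \<phi> f\<^sub>1 + \<phi> f\<^sub>2"
        using int[OF f1] int[OF f2] by (simp add: \<phi>_def)
    qed
    moreover have "\<phi> (\<lambda>x. c * f x) = c * \<phi> f" if "integrable lebesgue f" for c f
    proof -
      have f: "f \<in> L1" and cf: "(\<lambda>x. c * f x) \<in> L1"
        using that by (auto simp: L1_def)
      have "AE x in lebesgue. A (\<lambda>x. c * f x) x = c * A f x"
        using lin f by (simp add: linear_L1_Linf_def)
      then have "\<phi> (\<lambda>x. c * f x) = (LINT x|lebesgue. c * (A f x * cnj (g x)))"
        unfolding \<phi>_def using Am[OF cf] Am[OF f] gm
        by (intro integral_cong_AE) (auto elim!: eventually_mono)
      then show ?thesis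
        by (simp add: \<phi>_def)
    qed
    ultimately obtain h where hm: "h \<in> borel_measurable lebesgue"
      and hb: "AE x in lebesgue. norm (h x) \<le> 2 * C"
      and h: "\<And>f. integrable lebesgue f \<Longrightarrow> \<phi> f = (LINT x|lebesgue. f x * h x)"
      using lebesgue.L1_functional_representation[of \<phi> C] by blast
    have "Linf_norm (\<lambda>x. cnj (h x)) \<le> ennreal (2 * C)"
      using hm hb by (intro Linf_norm_le) auto
    then have "(\<lambda>x. cnj (h x)) \<in> Linf"
      using hm by (auto simp: Linf_def intro: le_less_trans)
    then show ?thesis
      using h by (intro bexI[of _ "\<lambda>x. cnj (h x)"]) (auto simp: \<phi>_def L1_def)
  qed
  then have "\<exists>B. \<forall>g\<in>L1. B g \<in> Linf \<and>
      (\<forall>f\<in>L1. (LINT x|lebesgue. A f x * cnj (g x)) = (LINT x|lebesgue. f x * cnj (B g x)))"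
    by (intro bchoice) blast
  then show ?thesis
    unfolding is_adjoint_def by blast
qed

lemma adjoint_contraction:
  assumes contr: "\<forall>f\<in>L1. Linf_norm (A f) \<le> L1_norm f" and lin: "linear_L1_Linf A"
    and B: "is_adjoint A B" and g: "g \<in> L1"
  shows "Linf_norm (B g) \<le> L1_norm g"
proof -
  have "B g \<in> Linf"
    using B g by (simp add: is_adjoint_def)
  then have Bm: "B g \<in> borel_measurable lebesgue"
    by (simp add: Linf_def)
  obtain K where K: "AE x in lebesgue. norm (B g x) \<le> K"
    using LinfE[OF \<open>B g \<in> Linf\<close>] by blast
  have "AE x in lebesgue. norm (cnj (B g x)) \<le> (\<integral>x. norm (g x) \<partial>lebesgue)"
  proof (rule lebesgue.AE_norm_le_if_pairing_bounded)
    show "(\<lambda>x. cnj (B g x)) \<in> borel_measurable lebesgue"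
      using Bm by (rule borel_measurable_cnj)
    show "AE x in lebesgue. norm (cnj (B g x)) \<le> K"
      using K by simp
    show "0 \<le> (\<integral>x. norm (g x) \<partial>lebesgue)"
      by simp
    fix f :: "real \<Rightarrow> complex"
    assume "integrable lebesgue f"
    then have f: "f \<in> L1"
      by (simp add: L1_def)
    then have "(LINT x|lebesgue. f x * cnj (B g x)) = (LINT x|lebesgue. A f x * cnj (g x))"
      using B g by (simp add: is_adjoint_def)
    then show "norm (LINT x|lebesgue. f x * cnj (B g x))
        \<le> (\<integral>x. norm (g x) \<partial>lebesgue) * (\<integral>x. norm (f x) \<partial>lebesgue)"
      using norm_pairing_le(2)[OF contr lin f g] by (simp add: mult.commute)
  qed
  then show ?thesis
    unfolding L1_norm_eq_integral[OF g] by (intro Linf_norm_le Bm) simp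
qed

section \<open>The uncertainty principle\<close>

theorem theorem4p5:
  fixes k :: real
    and A :: "(real \<Rightarrow> complex) \<Rightarrow> (real \<Rightarrow> complex)"
    and f :: "real \<Rightarrow> complex"
  assumes "k > 0"
    and "linear_L1_Linf A"
    and "k_Hadamard k A"
    and "doubly_L1 A f"
  shows "L1_norm f * L1_norm (A f) \<ge> ennreal k * Linf_norm f * Linf_norm (A f)"
proof -
  have contr: "\<forall>f\<in>L1. Linf_norm (A f) \<le> L1_norm f"
    and lower: "ennreal k * Linf_norm f \<le> Linf_norm (adjoint_op A (A f))"
    using assms(3,4) by (auto simp: k_Hadamard_def)
  have f: "f \<in> L1" and Af: "A f \<in> L1"
    using assms(4) by (auto simp: doubly_L1_def)
  have "is_adjoint A (adjoint_op A)"
    unfolding adjoint_op_def using ex_adjoint[OF contr assms(2)] by (rule someI_ex)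
  then have "Linf_norm (adjoint_op A (A f)) \<le> L1_norm (A f)"
    by (rule adjoint_contraction[OF contr assms(2) _ Af])
  with lower have "ennreal k * Linf_norm f \<le> L1_norm (A f)"
    by (rule order_trans)
  moreover have "Linf_norm (A f) \<le> L1_norm f"
    using contr f by blast
  ultimately have "ennreal k * Linf_norm f * Linf_norm (A f) \<le> L1_norm (A f) * L1_norm f"
    by (rule mult_mono) auto
  then show ?thesis
    by (simp add: mult.commute)
qed

end
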